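(* Let $\mathcal{X}\subseteq\mathbb{R}^n$ be a compact convex set, let $f$ be an $(M,\nu)$ generalized self-concordant function with $\nu\ge2$, and let $\mathbf{x}_0\in\mathcal{X}\cap\mathrm{dom}(f)$. Let $\mathcal{L}_0=\{\mathbf{x}\in\mathrm{dom}(f)\cap\mathcal{X}: f(\mathbf{x})\le f(\mathbf{x}_0)\}$ and $$T_\nu=\begin{cases}\lceil 4MD\rceil-2&\text{if }\nu=2,\\ \lceil 2MD\,(L_f^{\mathcal{L}_0})^{\nu/2-1}(\nu-2)\rceil-2&\text{if }\nu>2.\end{cases}$$ Then, if the Monotonic Frank-Wolfe algorithm is run from $\mathbf{x}_0$ for $T\ge T_\nu+6$ iterations, one has $\min_{1\le t\le T}g(\mathbf{x}_t)\le\mathcal{O}(1/T)$; that is, there is a constant $C$, depending only on the problem data ($f$, $M$, $\nu$, $\mathcal{X}$, $\mathbf{x}_0$) and not on $T$, such that for every sequence $(\mathbf{x}_t)_{t\ge0}$ generated by the algorithm and every integer $T\ge T_\nu+6$, $$\min_{1\le t\le T}g(\mathbf{x}_t)\le\frac{C}{T}.$$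
   Context: Generalized self-concordance: let $f:\mathbb{R}^n\to\mathbb{R}\cup\{+\infty\}$ be a closed convex function whose domain $\mathrm{dom}(f)=\{\mathbf{x}: f(\mathbf{x})<+\infty\}$ is open, with $f\in C^3(\mathrm{dom}(f))$. For $M\ge 0$, $f$ is $(M,\nu)$ generalized self-concordant if for all $\mathbf{x}\in\mathrm{dom}(f)$ and $\mathbf{u},\mathbf{w}\in\mathbb{R}^n$ (with $\mathbf{w}\ne 0$ if $\nu>3$) $$|\langle D^3f(\mathbf{x})[\mathbf{w}]\mathbf{u},\mathbf{u}\rangle|\le M\,\|\mathbf{u}\|_{\nabla^2f(\mathbf{x})}^2\,\|\mathbf{w}\|_{\nabla^2f(\mathbf{x})}^{\nu-2}\,\|\mathbf{w}\|_2^{3-\nu},$$ where $D^3f(\mathbf{x})[\mathbf{w}]=\lim_{\alpha\to0}\alpha^{-1}(\nabla^2f(\mathbf{x}+\alpha\mathbf{w})-\nabla^2f(\mathbf{x}))$, $\|\mathbf{u}\|_H^2=\langle H\mathbf{u},\mathbf{u}\rangle$, and $0^0=1$. Notation: $\|\cdot\|$ is the Euclidean norm; $D=\max_{\mathbf{x},\mathbf{y}\in\mathcal{X}}\|\mathbf{x}-\mathbf{y}\|$; for $\mathbf{x}\in\mathcal{X}\cap\mathrm{dom}(f)$ the Frank-Wolfe gap is $g(\mathbf{x})=\max_{\mathbf{v}\in\mathcal{X}}\langle\nabla f(\mathbf{x}),\mathbf{x}-\mathbf{v}\rangle$. For a compact convex set $\mathcal{C}\subseteq\mathrm{dom}(f)$,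 $L_f^{\mathcal{C}}=\max_{\mathbf{u}\in\mathcal{C},\,\mathbf{d}\neq0}\|\mathbf{d}\|^2_{\nabla^2f(\mathbf{u})}/\|\mathbf{d}\|^2$. Monotonic Frank-Wolfe algorithm: given $\mathbf{x}_0\in\mathcal{X}\cap\mathrm{dom}(f)$, for $t=0,1,2,\dots$: choose $\mathbf{v}_t\in\arg\min_{\mathbf{v}\in\mathcal{X}}\langle\nabla f(\mathbf{x}_t),\mathbf{v}\rangle$ (any minimizer), set $\gamma_t=2/(t+2)$ and $\mathbf{y}_t=\mathbf{x}_t+\gamma_t(\mathbf{v}_t-\mathbf{x}_t)$; if $\mathbf{y}_t\notin\mathrm{dom}(f)$ or $f(\mathbf{y}_t)>f(\mathbf{x}_t)$ set $\mathbf{x}_{t+1}=\mathbf{x}_t$, otherwise set $\mathbf{x}_{t+1}=\mathbf{y}_t$. *)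

theory Defs
  imports "HOL-Analysis.Analysis"
begin

definition edom :: "('a \<Rightarrow> ereal) \<Rightarrow> 'a set" where
  "edom f = {x. f x < \<infinity>}"

text \<open>Real-valued version of an extended-valued function, meaningful on its domain only.\<close>

definition fin_part :: "('a \<Rightarrow> ereal) \<Rightarrow> 'a \<Rightarrow> real" where
  "fin_part f x = real_of_ereal (f x)"

text \<open>The value \<open>-\<infinity>\<close> is excluded; a function is closed when its epigraph is.\<close>

definition closed_convex_fun :: "('a::euclidean_space \<Rightarrow> ereal) \<Rightarrow> bool" where
  "closed_convex_fun f \<longleftrightarrow>
     (\<forall>x. f x \<noteq> -\<infinity>) \<and>
     convex_on (edom f) (fin_part f) \<and>
     closed (epigraph (edom f) (fin_part f))"

text \<open>\<open>k\<close> times continuously differentiable on an open set: all iterated directional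
  derivatives up to order \<open>k\<close> exist, those of order less than \<open>k\<close> are Frechet differentiable,
  and those of order \<open>k\<close> are continuous.\<close>

primrec Ck_on :: "nat \<Rightarrow> ('a::euclidean_space \<Rightarrow> real) \<Rightarrow> 'a set \<Rightarrow> bool" where
  "Ck_on 0 F S \<longleftrightarrow> continuous_on S F"
| "Ck_on (Suc k) F S \<longleftrightarrow>
     (\<forall>x\<in>S. F differentiable (at x)) \<and>
     (\<forall>w. Ck_on k (\<lambda>x. frechet_derivative F (at x) w) S)"

definition grad :: "(real^'n \<Rightarrow> ereal) \<Rightarrow> real^'n \<Rightarrow> real^'n" where
  "grad f x = (THE D. GDERIV (fin_part f) x :> D)"

definition hess :: "(real^'n \<Rightarrow> ereal) \<Rightarrow> real^'n \<Rightarrow> real^'n^'n" where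
  "hess f x = jacobian (grad f) (at x)"

definition D3 :: "(real^'n \<Rightarrow> ereal) \<Rightarrow> real^'n \<Rightarrow> real^'n \<Rightarrow> real^'n^'n" where
  "D3 f x w = Lim (at 0) (\<lambda>\<alpha>::real. (1 / \<alpha>) *\<^sub>R (hess f (x + \<alpha> *\<^sub>R w) - hess f x))"

definition mnorm_sq :: "real^'n^'n \<Rightarrow> real^'n \<Rightarrow> real" where
  "mnorm_sq H u = (H *v u) \<bullet> u"

definition mnorm :: "real^'n^'n \<Rightarrow> real^'n \<Rightarrow> real" where
  "mnorm H u = sqrt (mnorm_sq H u)"

text \<open>The library's \<open>powr\<close> has \<open>0 powr 0 = 0\<close>; here \<open>0\<close> to the power \<open>0\<close> must be \<open>1\<close>.\<close>

definition rpow :: "real \<Rightarrow> real \<Rightarrow> real" where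
  "rpow b a = (if a = 0 then 1 else b powr a)"

text \<open>For \<open>\<nu> \<ge> 2\<close>, zero is never raised to a negative power below. For \<open>\<nu> < 2\<close> that could
  happen in directions where the Hessian seminorm vanishes, so the definition is intended
  for \<open>\<nu> \<ge> 2\<close> only.\<close>

definition gen_self_concordant :: "real \<Rightarrow> real \<Rightarrow> (real^'n \<Rightarrow> ereal) \<Rightarrow> bool" where
  "gen_self_concordant M \<nu> f \<longleftrightarrow>
     M \<ge> 0 \<and> closed_convex_fun f \<and> open (edom f) \<and> Ck_on 3 (fin_part f) (edom f) \<and>
     (\<forall>x\<in>edom f. \<forall>u w. (\<nu> > 3 \<longrightarrow> w \<noteq> 0) \<longrightarrow>
        \<bar>(D3 f x w *v u) \<bullet> u\<bar>
          \<le> M * mnorm_sq (hess f x) u * rpow (mnorm (hess f x) w) (\<nu> - 2)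
              * rpow (norm w) (3 - \<nu>))"

text \<open>The maxima over compact sets are written as suprema.\<close>

definition fw_gap :: "(real^'n \<Rightarrow> ereal) \<Rightarrow> (real^'n) set \<Rightarrow> real^'n \<Rightarrow> real" where
  "fw_gap f X x = (SUP v\<in>X. grad f x \<bullet> (x - v))"

definition smoothness_const :: "(real^'n \<Rightarrow> ereal) \<Rightarrow> (real^'n) set \<Rightarrow> real" where
  "smoothness_const f C =
     (SUP (u, d) \<in> C \<times> (UNIV - {0}). mnorm_sq (hess f u) d / (norm d)\<^sup>2)"

definition init_level_set :: "(real^'n \<Rightarrow> ereal) \<Rightarrow> (real^'n) set \<Rightarrow> real^'n \<Rightarrow> (real^'n) set" where
  "init_level_set f X x0 = {x \<in> edom f \<inter> X. f x \<le> f x0}"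

definition burn_in :: "real \<Rightarrow> real \<Rightarrow> (real^'n \<Rightarrow> ereal) \<Rightarrow> (real^'n) set \<Rightarrow> real^'n \<Rightarrow> int" where
  "burn_in M \<nu> f X x0 =
     (if \<nu> = 2 then \<lceil>4 * M * diameter X\<rceil> - 2
      else \<lceil>2 * M * diameter X *
              rpow (smoothness_const f (init_level_set f X x0)) (\<nu> / 2 - 1) * (\<nu> - 2)\<rceil> - 2)"

text \<open>\<open>x\<close> is a sequence of iterates and \<open>v\<close> the corresponding sequence of (arbitrarily chosen)
  minimizers of the linear subproblems.\<close>

definition monotonic_fw ::
  "(real^'n \<Rightarrow> ereal) \<Rightarrow> (real^'n) set \<Rightarrow> real^'n \<Rightarrow> (nat \<Rightarrow> real^'n) \<Rightarrow> (nat \<Rightarrow> real^'n) \<Rightarrow> bool"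
where
  "monotonic_fw f X x0 x v \<longleftrightarrow>
     x 0 = x0 \<and>
     (\<forall>t. is_arg_min (\<lambda>z. grad f (x t) \<bullet> z) (\<lambda>z. z \<in> X) (v t) \<and>
          (let \<gamma> = 2 / (real t + 2);
               y = x t + \<gamma> *\<^sub>R (v t - x t)
           in x (Suc t) = (if y \<notin> edom f \<or> f y > f (x t) then x t else y)))"

end

theory Submission imports Defs begin

text \<open>The initial level set \<open>K\<close> is compact: it is a slice of the closed epigraph,
  intersected with \<open>X\<close>. It lies in the open domain, so some closed
  \<delta>-neighbourhood of it is compact and still inside the domain. There the continuous second
  derivatives give a single \<open>L\<close> with F(x + d) \<le> F(x) + F'(x)d + L |d|^2 for all x
  in \<open>K\<close> and |d| \<le> \<delta> (\<open>C2_quadratic_upper_bound\<close>).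

  The acceptance test keeps every iterate in \<open>K\<close>. A candidate step has length at most
  2D/(t+2), so from some index \<open>t0\<close> on all candidates are in the domain and obey the
  classical Frank-Wolfe descent h(t+1) \<le> h(t) - 2 g(t)/(t+2) + c/(t+2)^2, where h is the excess
  of F over its minimum on \<open>K\<close> and g is the gap. Convexity gives h \<le> g
  (\<open>convex_on_gradient_inequality\<close>).

  \<open>frank_wolfe_rate\<close> turns this recursion into the bound on the smallest gap once T
  \<ge> 2 t0. For the finitely many smaller T the gap is merely bounded on \<open>K\<close>, and a
  larger constant covers them. All constants come from \<open>K\<close>, \<open>X\<close> and
  \<open>f\<close>, never from the run.\<close>

section \<open>From a descent recursion to an O(1/T) bound on the smallest gap\<close>

text \<open>Since h \<le> g, the recursion first forces h to decay like A/(t+2). If all gaps then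
  stayed above a multiple of 1/T, the descent summed over the second half of the run would make h
  negative.\<close>

lemma frank_wolfe_rate:
  fixes h g :: "nat \<Rightarrow> real"
  assumes "c \<ge> 0" "A > 0"
    and c: "c \<le> A" and start: "h t0 \<le> A / (real t0 + 2)"
    and nonneg: "\<And>t. h t \<ge> 0" and le: "\<And>t. h t \<le> g t"
    and descent: "\<And>t. t \<ge> t0 \<Longrightarrow> h (Suc t) \<le> h t - 2 / (real t + 2) * g t + c / (real t + 2)\<^sup>2"
    and T: "T \<ge> 2 * t0" "T \<ge> 1"
  shows "\<exists>t\<in>{1..T}. g t \<le> 6 * (A + c) / real T"
proof (rule ccontr)
  \<comment> \<open>With g replaced by h, one step contracts h by t/(t+2) and adds at most
    A/(t+2)^2. The induction closes because (t+1)(t+3) \<le> (t+2)^2.\<close>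
  have decay: "h t \<le> A / (real t + 2)" if "t \<ge> t0" for t
    using that
  proof (induction t rule: dec_induct)
    case base
    then show ?case using start by simp
  next
    case (step t)
    have "2 / (real t + 2) * h t \<le> 2 / (real t + 2) * g t"
      by (intro mult_left_mono le) auto
    then have "h (Suc t) \<le> h t - 2 / (real t + 2) * h t + c / (real t + 2)\<^sup>2"
      using descent[OF step(1)] by linarith
    also have "\<dots> = real t / (real t + 2) * h t + c / (real t + 2)\<^sup>2"
      by (simp add: field_simps)
    also have "\<dots> \<le> real t / (real t + 2) * (A / (real t + 2)) + A / (real t + 2)\<^sup>2"
      using step.IH c by (intro add_mono mult_left_mono divide_right_mono) auto
    also have "\<dots> = A * ((real t + 1) / (real t + 2)\<^sup>2)"
      by (simp add: power2_eq_square add_divide_distrib algebra_simps)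
    also have "\<dots> \<le> A * (1 / (real (Suc t) + 2))"
    proof -
      have "(real t + 1) * (real (Suc t) + 2) \<le> (real t + 2)\<^sup>2"
        by (simp add: power2_eq_square algebra_simps)
      then show ?thesis
        using \<open>A > 0\<close> by (intro mult_left_mono) (auto simp: pos_divide_le_eq pos_le_divide_eq)
    qed
    finally show ?case by simp
  qed
  \<comment> \<open>The midpoint, rounded up: it is at least \<open>t0\<close> because T \<ge> 2 t0,
    and at least 1, so that only gaps with index in \<open>{1..T}\<close> are summed.\<close>
  define s where "s = Suc T div 2"
  have s: "T \<le> 2 * s" "2 * s \<le> Suc T" "s \<ge> t0" "s \<ge> 1"
    using T by (auto simp: s_def)
  define m where "m = 6 * (A + c) / real T"
  assume "\<not> (\<exists>t\<in>{1..T}. g t \<le> 6 * (A + c) / real T)"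
  then have big: "g t > m" if "t \<in> {1..T}" for t
    using that by (auto simp: m_def not_le)
  have m0: "m \<ge> 0" using assms by (simp add: m_def)
  have total_descent: "h (s + k) \<le> h s - real k * (2 * m / (real T + 2)) + real k * (c / (real s + 2)\<^sup>2)"
    if "s + k \<le> Suc T" for k
    using that
  proof (induction k)
    case (Suc k)
    let ?t = "s + k"
    have "2 / (real T + 2) * m \<le> 2 / (real ?t + 2) * g ?t"
      using big[of ?t] m0 s Suc.prems by (intro mult_mono divide_left_mono) auto
    moreover have "c / (real ?t + 2)\<^sup>2 \<le> c / (real s + 2)\<^sup>2"
      using \<open>c \<ge> 0\<close> by (intro divide_left_mono power_mono) auto
    moreover have "h (Suc ?t) \<le> h ?t - 2 / (real ?t + 2) * g ?t + c / (real ?t + 2)\<^sup>2"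
      using s by (intro descent) auto
    moreover have "h ?t \<le> h s - real k * (2 * m / (real T + 2)) + real k * (c / (real s + 2)\<^sup>2)"
      using Suc by simp
    ultimately have "h (Suc ?t) \<le> h s - (real k * (2 * m / (real T + 2)) + 2 / (real T + 2) * m)
        + (real k * (c / (real s + 2)\<^sup>2) + c / (real s + 2)\<^sup>2)"
      by linarith
    then show ?case by (simp add: algebra_simps add_divide_distrib)
  qed simp
  \<comment> \<open>The number of steps from \<open>s\<close> through T. Below, they lower h by at
    least m/3 and raise it by at most c/(s+2); as h(s) \<le> A/(s+2) and (A+c)/(s+2) < 2(A+c)/T =
    m/3, this is where the factor 6 in \<open>m\<close> comes from.\<close>
  define k where "k = Suc T - s"
  have k: "s + k = Suc T" "2 * k \<ge> T" "k \<le> s + 2" "2 * k \<ge> Suc T" "k \<ge> 1"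
    using s unfolding k_def by auto
  have "m / 3 \<le> real k * (2 * m / (real T + 2))"
  proof -
    have "(real T + 2) * m \<le> (6 * real k) * m"
      using k T m0 by (intro mult_right_mono) auto
    then show ?thesis by (simp add: field_simps)
  qed
  moreover have "real k * (c / (real s + 2)\<^sup>2) \<le> c / (real s + 2)"
  proof -
    have "real k * (c / (real s + 2)\<^sup>2) \<le> (real s + 2) * (c / (real s + 2)\<^sup>2)"
      using k \<open>c \<ge> 0\<close> by (intro mult_right_mono) auto
    then show ?thesis by (simp add: power2_eq_square)
  qed
  moreover have "(A + c) / (real s + 2) < m / 3"
  proof -
    have "(A + c) * real T < (A + c) * (2 * (real s + 2))"
      using assms(1,2) s by (intro mult_strict_left_mono) auto
    then show ?thesis using T by (simp add: m_def field_simps)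
  qed
  moreover have "h (s + k) \<ge> 0" by (rule nonneg)
  moreover have "h (s + k) \<le> h s - real k * (2 * m / (real T + 2)) + real k * (c / (real s + 2)\<^sup>2)"
    using k by (intro total_descent) simp
  moreover have "h s \<le> A / (real s + 2)"
    using s by (intro decay)
  ultimately show False
    unfolding add_divide_distrib by linarith
qed

section \<open>Convexity and smoothness estimates\<close>

lemma Ck_on_SucD: "Ck_on (Suc k) F S \<Longrightarrow> Ck_on k F S"
proof (induction k arbitrary: F)
  case 0
  then have "isCont F x" if "x \<in> S" for x
    using that differentiable_imp_continuous_within[of F x UNIV] by simp
  then show ?case by (simp add: continuous_at_imp_continuous_on)
next
  case (Suc k)
  then show ?case unfolding Ck_on.simps(2) by blast
qed

text \<open>On the segment from x to z the difference quotient is at most F z - F x by convexity;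
  let the parameter tend to 0 from the right.\<close>

lemma convex_on_gradient_inequality:
  fixes F :: "'a::real_normed_vector \<Rightarrow> real"
  assumes convex: "convex_on S F" and "x \<in> S" "z \<in> S"
    and deriv: "(F has_derivative F') (at x)"
  shows "F x + F' (z - x) \<le> F z"
proof -
  let ?p = "\<lambda>s. F (x + s *\<^sub>R (z - x))"
  have "((\<lambda>s. x + s *\<^sub>R (z - x)) has_derivative (\<lambda>s. s *\<^sub>R (z - x))) (at 0 within {0..1})"
    by (auto intro!: derivative_eq_intros)
  from has_derivative_compose[OF this, of F F'] deriv
  have "(?p has_derivative (\<lambda>s. F' (s *\<^sub>R (z - x)))) (at 0 within {0..1})"
    by simp
  then have p': "(?p has_real_derivative F' (z - x)) (at 0 within {0..1})"
    by (simp add: has_field_derivative_def linear_scale[OF has_derivative_linear[OF deriv]]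
        mult.commute[of _ "F' (z - x)"])
  then have lim: "((\<lambda>s. (?p s - ?p 0) / (s - 0)) \<longlongrightarrow> F' (z - x)) (at 0 within {0..1})"
    by (simp only: has_field_derivative_iff)
  have "F' (z - x) \<le> F z - F x"
  proof (rule tendsto_upperbound[OF lim])
    show "\<forall>\<^sub>F s in at 0 within {0..1}. (?p s - ?p 0) / (s - 0) \<le> F z - F x"
      unfolding eventually_at
    proof (intro exI[of _ 1] conjI ballI impI)
      fix s :: real assume s: "s \<in> {0..1}" "s \<noteq> 0 \<and> dist s 0 < 1"
      have "F ((1 - s) *\<^sub>R x + s *\<^sub>R z) \<le> (1 - s) * F x + s * F z"
        using s assms by (intro convex_onD[OF convex]) auto
      moreover have "(1 - s) *\<^sub>R x + s *\<^sub>R z = x + s *\<^sub>R (z - x)"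
        by (simp add: algebra_simps)
      ultimately show "(?p s - ?p 0) / (s - 0) \<le> F z - F x"
        using s by (simp add: divide_simps algebra_simps)
    qed simp
    show "at (0::real) within {0..1} \<noteq> bot"
      by (simp add: trivial_limit_within islimpt_Icc)
  qed
  then show ?thesis by simp
qed

lemma linear_eq_sum_Basis:
  fixes f :: "'a::euclidean_space \<Rightarrow> real"
  assumes "linear f"
  shows "f x = (\<Sum>i\<in>Basis. (x \<bullet> i) * f i)"
  by (subst (1) euclidean_representation[of x, symmetric])
    (simp add: linear_sum[OF assms] linear_scale[OF assms])

text \<open>The sum of the absolute partial derivatives is continuous, hence bounded on
  \<open>K\<close>, and dominates the operator norm of the derivative. The mean value inequality
  needs a convex set, so it is applied on convex \<open>C\<close> inside \<open>K\<close>, with a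
  constant that does not depend on \<open>C\<close>.\<close>

lemma C1_Lipschitz_on_compact:
  fixes q :: "'a::euclidean_space \<Rightarrow> real"
  assumes q: "Ck_on 1 q S" and "compact K" "K \<subseteq> S"
  shows "\<exists>B\<ge>0. \<forall>C x y. convex C \<longrightarrow> C \<subseteq> K \<longrightarrow> x \<in> C \<longrightarrow> y \<in> C \<longrightarrow> \<bar>q y - q x\<bar> \<le> B * norm (y - x)"
proof -
  let ?D = "\<lambda>x. frechet_derivative q (at x)"
  have deriv: "(q has_derivative ?D x) (at x)" if "x \<in> S" for x
    using q that by (simp add: frechet_derivative_works[symmetric])
  have "continuous_on K (\<lambda>x. ?D x i)" for i
    using q by (intro continuous_on_subset[OF _ \<open>K \<subseteq> S\<close>]) simp
  then have "continuous_on K (\<lambda>x. \<Sum>i\<in>Basis. \<bar>?D x i\<bar>)"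
    by (intro continuous_on_sum continuous_on_rabs)
  then have "bounded ((\<lambda>x. \<Sum>i\<in>Basis. \<bar>?D x i\<bar>) ` K)"
    using \<open>compact K\<close> by (intro compact_imp_bounded compact_continuous_image)
  then obtain B where "B > 0" and "\<And>x. x \<in> K \<Longrightarrow> norm (\<Sum>i\<in>Basis. \<bar>?D x i\<bar>) \<le> B"
    unfolding bounded_pos ball_simps by blast
  then have B: "(\<Sum>i\<in>Basis. \<bar>?D x i\<bar>) \<le> B" if "x \<in> K" for x
    using that unfolding real_norm_def by (meson abs_ge_self order_trans)
  have onorm: "onorm (?D x) \<le> B" if "x \<in> K" for x
  proof (rule onorm_bound)
    fix w
    have "linear (?D x)"
      using deriv[THEN has_derivative_linear] that \<open>K \<subseteq> S\<close> by (meson subsetD)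
    then have "\<bar>?D x w\<bar> = \<bar>\<Sum>i\<in>Basis. (w \<bullet> i) * ?D x i\<bar>"
      by (simp only: linear_eq_sum_Basis[of "?D x" w])
    also have "\<dots> \<le> (\<Sum>i\<in>Basis. norm w * \<bar>?D x i\<bar>)"
      by (rule order_trans[OF sum_abs])
        (auto intro!: sum_mono mult_right_mono Basis_le_norm simp: abs_mult)
    also have "\<dots> \<le> norm w * B"
      using B[OF that] by (simp add: sum_distrib_left[symmetric] mult_left_mono)
    finally show "norm (?D x w) \<le> B * norm w"
      by (simp add: mult.commute)
  qed (use \<open>B > 0\<close> in simp)
  have "\<bar>q y - q x\<bar> \<le> B * norm (y - x)" if "convex C" "C \<subseteq> K" "x \<in> C" "y \<in> C" for C x y
  proof -
    have "norm (q y - q x) \<le> B * norm (y - x)"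
    proof (rule differentiable_bound[OF \<open>convex C\<close> _ _ \<open>y \<in> C\<close> \<open>x \<in> C\<close>])
      show "(q has_derivative ?D z) (at z within C)" if "z \<in> C" for z
        using that \<open>C \<subseteq> K\<close> \<open>K \<subseteq> S\<close> by (blast intro: has_derivative_at_withinI[OF deriv])
      show "onorm (?D z) \<le> B" if "z \<in> C" for z
        using that \<open>C \<subseteq> K\<close> by (intro onorm) auto
    qed
    then show ?thesis by simp
  qed
  then show ?thesis using less_imp_le[OF \<open>B > 0\<close>] by (intro exI[of _ B] conjI allI impI)
qed

text \<open>A local form of smoothness: the partial derivatives are Lipschitz on each \<delta>-ball
  around a point of \<open>K\<close>, with constants uniform over \<open>K\<close>. This bounds the
  change of the derivative along a short segment.\<close>

lemma C2_quadratic_upper_bound: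
  fixes F :: "'a::euclidean_space \<Rightarrow> real"
  assumes F: "Ck_on 2 F S" and "open S" "compact K" "K \<subseteq> S"
  shows "\<exists>L\<ge>0. \<exists>\<delta>>0. \<forall>x\<in>K. \<forall>d. norm d \<le> \<delta> \<longrightarrow> x + d \<in> S \<and>
           F (x + d) \<le> F x + frechet_derivative F (at x) d + L * (norm d)\<^sup>2"
proof -
  let ?D = "\<lambda>x. frechet_derivative F (at x)"
  have F1: "Ck_on 1 (\<lambda>x. ?D x w) S" for w
    using F by (simp add: numeral_2_eq_2)
  have deriv: "(F has_derivative ?D x) (at x)" if "x \<in> S" for x
    using F that by (simp add: numeral_2_eq_2 frechet_derivative_works[symmetric])
  obtain \<delta> where "\<delta> > 0" and \<delta>: "(\<Union>x\<in>K. cball x \<delta>) \<subseteq> S"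
    using compact_subset_open_imp_cball_epsilon_subset[OF \<open>compact K\<close> \<open>open S\<close> \<open>K \<subseteq> S\<close>] by blast
  \<comment> \<open>The closed \<delta>-neighbourhood of \<open>K\<close>. It is compact as a sum of
    compact sets, and contains the balls on which the Lipschitz bound is used.\<close>
  define K' where "K' = {x + y | x y. x \<in> K \<and> y \<in> cball (0::'a) \<delta>}"
  have "compact K'"
    unfolding K'_def using \<open>compact K\<close> by (intro compact_sums) auto
  have cball_K': "cball x \<delta> \<subseteq> K'" if "x \<in> K" for x
  proof
    fix y assume "y \<in> cball x \<delta>"
    then have "y = x + (y - x)" "y - x \<in> cball 0 \<delta>" by (auto simp: dist_norm norm_minus_commute)
    then show "y \<in> K'" unfolding K'_def using that by blast
  qed
  have "K' \<subseteq> S"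
  proof
    fix z assume "z \<in> K'"
    then obtain x y where "x \<in> K" "z = x + y" "norm y \<le> \<delta>" by (auto simp: K'_def)
    then have "z \<in> cball x \<delta>" by (simp add: dist_norm)
    then show "z \<in> S" using \<delta> \<open>x \<in> K\<close> by blast
  qed
  have "\<forall>w. \<exists>B\<ge>0. \<forall>C x y. convex C \<longrightarrow> C \<subseteq> K' \<longrightarrow> x \<in> C \<longrightarrow> y \<in> C \<longrightarrow> \<bar>?D y w - ?D x w\<bar> \<le> B * norm (y - x)"
    using C1_Lipschitz_on_compact[OF F1 \<open>compact K'\<close> \<open>K' \<subseteq> S\<close>] by blast
  then obtain B where B0: "\<And>w. B w \<ge> 0" and
    B: "\<And>w C x y. convex C \<Longrightarrow> C \<subseteq> K' \<Longrightarrow> x \<in> C \<Longrightarrow> y \<in> C \<Longrightarrow> \<bar>?D y w - ?D x w\<bar> \<le> B w * norm (y - x)"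
    by metis
  define L where "L = (\<Sum>i\<in>Basis. B i)"
  have "F (x + d) \<le> F x + ?D x d + L * (norm d)\<^sup>2" if "x \<in> K" "norm d \<le> \<delta>" for x d
  proof -
    have seg: "x + s *\<^sub>R d \<in> cball x \<delta>" if "s \<in> {0..1}" for s
      using that \<open>norm d \<le> \<delta>\<close> mult_left_le_one_le[of "norm d" "\<bar>s\<bar>"] by (simp add: dist_norm)
    then have segS: "x + s *\<^sub>R d \<in> S" if "s \<in> {0..1}" for s
      using that cball_K' \<open>x \<in> K\<close> \<open>K' \<subseteq> S\<close> by blast
    have "((\<lambda>s. F (x + s *\<^sub>R d)) has_derivative (\<lambda>h. ?D (x + s *\<^sub>R d) (h *\<^sub>R d))) (at s within {0..1})"
      if "s \<in> {0..1}" for s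
      by (rule has_derivative_compose[where f = "\<lambda>s. x + s *\<^sub>R d" and g = F and g' = "?D (x + s *\<^sub>R d)"])
        (use deriv[OF segS[OF that]] in \<open>auto intro!: derivative_eq_intros\<close>)
    \<comment> \<open>The mean value theorem moves the derivative to an intermediate point
      \<open>?y\<close>; returning to x costs at most \<open>L\<close> times the squared length,
      with no factor 1/2.\<close>
    then obtain s where s: "s \<in> {0..1}" and mvt: "F (x + d) - F x = ?D (x + s *\<^sub>R d) d"
      using mvt_very_simple[of 0 1 "\<lambda>s. F (x + s *\<^sub>R d)" "\<lambda>s h. ?D (x + s *\<^sub>R d) (h *\<^sub>R d)"] by auto
    let ?y = "x + s *\<^sub>R d"
    have "x \<in> S" using \<open>x \<in> K\<close> \<open>K \<subseteq> S\<close> by blast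
    have expand: "?D z d = (\<Sum>i\<in>Basis. (d \<bullet> i) * ?D z i)" if "z \<in> S" for z
      using deriv[OF that] by (intro linear_eq_sum_Basis has_derivative_linear)
    have "?D ?y d - ?D x d = (\<Sum>i\<in>Basis. (d \<bullet> i) * (?D ?y i - ?D x i))"
      using expand[OF segS[OF s]] expand[OF \<open>x \<in> S\<close>] by (simp add: sum_subtractf right_diff_distrib)
    also have "\<dots> \<le> (\<Sum>i\<in>Basis. norm d * (B i * norm d))"
    proof (rule sum_mono)
      fix i :: 'a assume "i \<in> Basis"
      have "\<bar>?D ?y i - ?D x i\<bar> \<le> B i * norm (?y - x)"
        using seg[OF s] cball_K'[OF \<open>x \<in> K\<close>] \<open>\<delta> > 0\<close> by (intro B[of "cball x \<delta>"]) auto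
      also have "\<dots> \<le> B i * norm d"
        using s B0 by (intro mult_left_mono) (auto simp: mult_left_le_one_le)
      finally have "\<bar>d \<bullet> i\<bar> * \<bar>?D ?y i - ?D x i\<bar> \<le> norm d * (B i * norm d)"
        using \<open>i \<in> Basis\<close> by (intro mult_mono Basis_le_norm) auto
      then show "(d \<bullet> i) * (?D ?y i - ?D x i) \<le> norm d * (B i * norm d)"
        by (metis abs_le_D1 abs_mult)
    qed
    also have "\<dots> = L * (norm d)\<^sup>2"
      by (simp add: L_def sum_distrib_left sum_distrib_right power2_eq_square mult_ac)
    finally show ?thesis using mvt by simp
  qed
  moreover have "x + d \<in> S" if "x \<in> K" "norm d \<le> \<delta>" for x d
    using that \<delta> by (force simp: dist_norm)
  moreover have "L \<ge> 0" using B0 by (simp add: L_def sum_nonneg)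
  ultimately show ?thesis using \<open>\<delta> > 0\<close> by blast
qed

section \<open>Gradient, level set and gap of the extended-valued function\<close>

text \<open>The adjoint of the derivative, applied to 1, is its Riesz representer; uniqueness of
  derivatives resolves the definite description in \<open>grad\<close>.\<close>

lemma grad_inner:
  assumes "fin_part f differentiable (at x)"
  shows "grad f x \<bullet> h = frechet_derivative (fin_part f) (at x) h"
proof -
  let ?D = "frechet_derivative (fin_part f) (at x)"
  have deriv: "(fin_part f has_derivative ?D) (at x)"
    using assms by (simp add: frechet_derivative_works[symmetric])
  have eq: "?D = (\<lambda>h. h \<bullet> adjoint ?D 1)"
    using adjoint_works[OF has_derivative_linear[OF deriv], of _ 1] by (simp add: fun_eq_iff inner_commute)
  then have "GDERIV (fin_part f) x :> adjoint ?D 1"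
    using deriv unfolding gderiv_def by simp
  moreover have "D = adjoint ?D 1" if "GDERIV (fin_part f) x :> D" for D
    using that calculation unfolding gderiv_def
    by (metis has_derivative_unique inner_commute vector_eq_rdot)
  ultimately have "grad f x = adjoint ?D 1"
    unfolding grad_def by blast
  then show ?thesis using eq by (metis inner_commute)
qed

lemma ereal_fin_part:
  assumes "closed_convex_fun f" "x \<in> edom f"
  shows "ereal (fin_part f x) = f x"
  using assms by (cases "f x") (auto simp: closed_convex_fun_def edom_def fin_part_def)

text \<open>The level set is the slice of the epigraph at height \<open>fin_part f x0\<close>, cut
  with \<open>X\<close>. Closedness of the epigraph makes it closed in the whole space although the
  domain is open.\<close>

lemma compact_init_level_set:
  assumes "closed_convex_fun f" "compact X" "x0 \<in> edom f"
  shows "compact (init_level_set f X x0)"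
proof -
  have "f x \<le> f x0 \<longleftrightarrow> fin_part f x \<le> fin_part f x0" if "x \<in> edom f" for x
    using assms that by (metis ereal_fin_part ereal_less_eq(3))
  then have "init_level_set f X x0 = X \<inter> (\<lambda>x. (x, fin_part f x0)) -` epigraph (edom f) (fin_part f)"
    by (auto simp: init_level_set_def mem_epigraph)
  moreover have "closed ((\<lambda>x. (x, fin_part f x0)) -` epigraph (edom f) (fin_part f))"
    using assms by (intro continuous_closed_vimage) (auto simp: closed_convex_fun_def intro!: continuous_intros)
  ultimately show ?thesis using assms(2) by (simp add: compact_Int_closed)
qed

lemma fw_gap_arg_min:
  assumes "is_arg_min (\<lambda>z. grad f x \<bullet> z) (\<lambda>z. z \<in> X) v"
  shows "fw_gap f X x = grad f x \<bullet> (x - v)"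
  unfolding fw_gap_def
  using assms by (intro cSup_eq_maximum) (auto simp: is_arg_min_linorder inner_diff_right)


section \<open>Choice of constants and the two ranges of T\<close>

theorem theorem2p6:
  fixes f :: "real^'n \<Rightarrow> ereal" and X :: "(real^'n) set" and x0 :: "real^'n" and M \<nu> :: real
  assumes "compact X" and "convex X"
    and "gen_self_concordant M \<nu> f" and "\<nu> \<ge> 2"
    and "x0 \<in> X \<inter> edom f"
  shows "\<exists>C::real. \<forall>x v. monotonic_fw f X x0 x v \<longrightarrow>
           (\<forall>T::nat. int T \<ge> burn_in M \<nu> f X x0 + 6 \<longrightarrow>
              Min ((\<lambda>t. fw_gap f X (x t)) ` {1..T}) \<le> C / real T)"
proof -
  define F where "F = fin_part f"
  define K where "K = init_level_set f X x0"
  define D where "D = diameter X"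
  have cc: "closed_convex_fun f" and "open (edom f)" and C3: "Ck_on 3 F (edom f)"
    using assms(3) by (auto simp: gen_self_concordant_def F_def)
  have C2: "Ck_on 2 F (edom f)"
    using C3 Ck_on_SucD[of 2] by simp
  have C1: "Ck_on 1 (\<lambda>x. frechet_derivative F (at x) w) (edom f)" for w
    using C2 by (simp add: numeral_2_eq_2)
  have diff: "F differentiable (at x)" if "x \<in> edom f" for x
    using C2 that by (simp add: numeral_2_eq_2)
  have grad: "grad f x \<bullet> h = frechet_derivative F (at x) h" if "x \<in> edom f" for x h
    using grad_inner diff[OF that] unfolding F_def by blast
  have convex: "convex_on (edom f) F"
    using cc by (simp add: closed_convex_fun_def F_def)
  have le_iff: "f x \<le> f y \<longleftrightarrow> F x \<le> F y" if "x \<in> edom f" "y \<in> edom f" for x y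
    using cc that ereal_fin_part ereal_less_eq(3) unfolding F_def by metis
  have "compact K"
    using assms cc by (auto simp: K_def intro: compact_init_level_set)
  have "K \<subseteq> edom f" "K \<subseteq> X" by (auto simp: K_def init_level_set_def)
  have "x0 \<in> K" using assms(5) by (simp add: K_def init_level_set_def)
  have diam: "norm (y - z) \<le> D" if "y \<in> X" "z \<in> X" for y z
    using diameter_bounded_bound[OF compact_imp_bounded[OF assms(1)] that] by (simp add: D_def dist_norm)
  have "D \<ge> 0" using diam[of x0 x0] assms(5) by simp
  have "continuous_on K F"
    using diff \<open>K \<subseteq> edom f\<close>
    by (auto intro!: continuous_at_imp_continuous_on differentiable_imp_continuous_within)
  then obtain xm where "xm \<in> K" and xm: "\<And>x. x \<in> K \<Longrightarrow> F xm \<le> F x"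
    using continuous_attains_inf[OF \<open>compact K\<close>] \<open>x0 \<in> K\<close> by blast
  \<comment> \<open>A gradient bound on \<open>K\<close>, for the short runs in which the descent
    estimate has no time to act.\<close>
  obtain G where G: "\<And>x. x \<in> K \<Longrightarrow> norm (grad f x) \<le> G"
  proof -
    have "continuous_on K (\<lambda>x. grad f x \<bullet> b)" for b
    proof -
      have "continuous_on (edom f) (\<lambda>x. frechet_derivative F (at x) b)"
        using Ck_on_SucD[of 0] C1[of b] by simp
      then have "continuous_on K (\<lambda>x. frechet_derivative F (at x) b)"
        using \<open>K \<subseteq> edom f\<close> by (rule continuous_on_subset)
      then show ?thesis
        by (rule continuous_on_eq) (use grad \<open>K \<subseteq> edom f\<close> in auto)
    qed
    then have "continuous_on K (grad f)"
      by (simp add: continuous_on_componentwise[of K "grad f"])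
    then have "bounded (grad f ` K)"
      using \<open>compact K\<close> by (intro compact_imp_bounded compact_continuous_image)
    then show ?thesis using that unfolding bounded_iff by blast
  qed
  obtain L \<delta> where "L \<ge> 0" "\<delta> > 0" and
    smooth: "\<And>x d. x \<in> K \<Longrightarrow> norm d \<le> \<delta> \<Longrightarrow> x + d \<in> edom f \<and>
           F (x + d) \<le> F x + frechet_derivative F (at x) d + L * (norm d)\<^sup>2"
    using C2_quadratic_upper_bound[OF C2 \<open>open (edom f)\<close> \<open>compact K\<close> \<open>K \<subseteq> edom f\<close>] by blast
  \<comment> \<open>From \<open>t0\<close> on, the step bound 2D/(t+2) is at most \<delta>. The
    other constants: \<open>c\<close> is L (2D)^2; \<open>A\<close> dominates \<open>c\<close> and
    the start of the decay at \<open>t0\<close>, with + 1 for strict positivity; \<open>C\<close>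
    covers both ranges of T.\<close>
  define t0 where "t0 = nat \<lceil>2 * D / \<delta>\<rceil>"
  define c where "c = 4 * L * D\<^sup>2"
  define A where "A = max c ((real t0 + 2) * (F x0 - F xm)) + 1"
  define C where "C = max (6 * (A + c)) (G * D * (2 * real t0))"
  have "c \<ge> 0" using \<open>L \<ge> 0\<close> by (simp add: c_def)
  then have "A > 0" "c \<le> A" by (auto simp: A_def)
  have "Min ((\<lambda>t. fw_gap f X (x t)) ` {1..T}) \<le> C / real T"
    if fw: "monotonic_fw f X x0 x v" and T: "int T \<ge> burn_in M \<nu> f X x0 + 6" for x v T
  proof -
    \<comment> \<open>The ceiling in \<open>burn_in\<close> is taken of a nonnegative number, as
      \<open>powr\<close> is nonnegative for every base. Hence T \<ge> 4, and the range of the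
      minimum is nonempty.\<close>
    have "burn_in M \<nu> f X x0 \<ge> -2"
    proof -
      have "M \<ge> 0" using assms(3) by (simp add: gen_self_concordant_def)
      then have "0 \<le> 4 * M * D"
        and "0 \<le> 2 * M * D * rpow (smoothness_const f (init_level_set f X x0)) (\<nu> / 2 - 1) * (\<nu> - 2)"
        using \<open>D \<ge> 0\<close> assms(4) by (simp_all add: rpow_def)
      then show ?thesis
        unfolding burn_in_def D_def by (smt (verit) zero_le_ceiling)
    qed
    then have "T \<ge> 1" using T by linarith
    have arg_min: "is_arg_min (\<lambda>z. grad f (x t) \<bullet> z) (\<lambda>z. z \<in> X) (v t)" for t
      using fw by (simp add: monotonic_fw_def)
    then have "v t \<in> X" for t by (simp add: is_arg_min_def)
    define y where "y = (\<lambda>t. x t + (2 / (real t + 2)) *\<^sub>R (v t - x t))"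
    have x_Suc: "x (Suc t) = (if y t \<notin> edom f \<or> f (y t) > f (x t) then x t else y t)" for t
      using fw by (simp add: monotonic_fw_def y_def Let_def)
    have xK: "x t \<in> K" for t
    proof (induction t)
      case 0
      then show ?case using fw \<open>x0 \<in> K\<close> by (simp add: monotonic_fw_def)
    next
      case (Suc t)
      have "y t = (1 - 2 / (real t + 2)) *\<^sub>R x t + (2 / (real t + 2)) *\<^sub>R v t"
        by (simp add: y_def algebra_simps)
      also have "\<dots> \<in> X"
        using Suc \<open>K \<subseteq> X\<close> \<open>v t \<in> X\<close> by (intro convexD_alt[OF assms(2)]) auto
      finally show ?case
        using Suc by (auto simp: x_Suc K_def init_level_set_def not_less)
    qed
    then have xX: "x t \<in> X" and xdom: "x t \<in> edom f" for t
      using \<open>K \<subseteq> X\<close> \<open>K \<subseteq> edom f\<close> by blast+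
    have gap: "fw_gap f X (x t) = grad f (x t) \<bullet> (x t - v t)" for t
      using arg_min by (rule fw_gap_arg_min)
    define h where "h = (\<lambda>t. F (x t) - F xm)"
    have mono: "F (x (Suc t)) \<le> F (x t)" for t
      using xdom[of t] by (auto simp: x_Suc not_less le_iff)
    have h_0: "h t \<le> F x0 - F xm" for t
    proof (induction t)
      case (Suc t)
      then show ?case using mono[of t] by (simp add: h_def)
    qed (use fw in \<open>simp add: h_def monotonic_fw_def\<close>)
    \<comment> \<open>Convexity bounds h by the linear decrease towards \<open>xm\<close>, and
      \<open>v t\<close> decreases the linear form at least as much.\<close>
    have h_gap: "h t \<le> fw_gap f X (x t)" for t
    proof -
      have "F (x t) + grad f (x t) \<bullet> (xm - x t) \<le> F xm"
        using convex_on_gradient_inequality[OF convex xdom[of t] _ frechet_derivative_works[THEN iffD1, OF diff[OF xdom[of t]]], of xm]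
          \<open>xm \<in> K\<close> \<open>K \<subseteq> edom f\<close> grad[OF xdom[of t]] by auto
      moreover have "grad f (x t) \<bullet> v t \<le> grad f (x t) \<bullet> xm"
        using arg_min[of t] \<open>xm \<in> K\<close> \<open>K \<subseteq> X\<close> by (auto simp: is_arg_min_linorder)
      ultimately show ?thesis by (simp add: h_def gap inner_diff_right)
    qed
    have step: "h (Suc t) \<le> h t - 2 / (real t + 2) * fw_gap f X (x t) + c / (real t + 2)\<^sup>2"
      if "t \<ge> t0" for t
    proof -
      let ?\<gamma> = "2 / (real t + 2)"
      let ?d = "?\<gamma> *\<^sub>R (v t - x t)"
      have d: "norm ?d \<le> ?\<gamma> * D"
        using diam[OF \<open>v t \<in> X\<close> xX] by (simp add: divide_right_mono)
      also have "\<dots> \<le> \<delta>"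
      proof -
        have "2 * D / \<delta> \<le> real t + 2"
          using that unfolding t0_def by linarith
        then show ?thesis using \<open>\<delta> > 0\<close> by (simp add: field_simps)
      qed
      finally have "y t \<in> edom f" and *: "F (y t) \<le> F (x t) + grad f (x t) \<bullet> ?d + L * (norm ?d)\<^sup>2"
        using smooth[OF xK[of t], of ?d] unfolding y_def grad[OF xdom[of t]] by blast+
      have "L * (norm ?d)\<^sup>2 \<le> L * (?\<gamma> * D)\<^sup>2"
        using d \<open>L \<ge> 0\<close> by (intro mult_left_mono power_mono) auto
      also have "\<dots> = c / (real t + 2)\<^sup>2"
        by (simp add: c_def power2_eq_square)
      finally have "F (y t) \<le> F (x t) - ?\<gamma> * fw_gap f X (x t) + c / (real t + 2)\<^sup>2"
        using * by (simp add: gap inner_diff_right algebra_simps)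
      \<comment> \<open>With \<open>y t\<close> in the domain, a rejection can only mean that
        \<open>y t\<close> has the larger value, so the new iterate is never worse than the
        candidate.\<close>
      moreover have "F (x (Suc t)) \<le> F (y t)"
        using \<open>y t \<in> edom f\<close> xdom[of t] le_iff[of "x t" "y t"] by (auto simp: x_Suc)
      ultimately show ?thesis by (simp add: h_def)
    qed
    have "\<exists>t\<in>{1..T}. fw_gap f X (x t) \<le> C / real T"
    proof (cases "T \<ge> 2 * t0")
      case True
      have "(real t0 + 2) * h t0 \<le> (real t0 + 2) * (F x0 - F xm)"
        by (intro mult_left_mono h_0) auto
      also have "\<dots> \<le> A" by (simp add: A_def)
      finally have "h t0 \<le> A / (real t0 + 2)" by (simp add: field_simps)
      then obtain t where "t \<in> {1..T}" "fw_gap f X (x t) \<le> 6 * (A + c) / real T"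
        using frank_wolfe_rate[OF \<open>c \<ge> 0\<close> \<open>A > 0\<close> \<open>c \<le> A\<close> _ _ h_gap step True \<open>T \<ge> 1\<close>] xm[OF xK]
        by (auto simp: h_def)
      moreover have "6 * (A + c) / real T \<le> C / real T"
        by (intro divide_right_mono) (auto simp: C_def)
      ultimately show ?thesis by force
    next
      case False
      \<comment> \<open>Here T < 2 t0, so the crude bound G D on the gap at the first iterate is
        already at most C/T.\<close>
      have "fw_gap f X (x 1) \<le> norm (grad f (x 1)) * norm (x 1 - v 1)"
        unfolding gap by (rule norm_cauchy_schwarz)
      also have "\<dots> \<le> G * D"
        using G[OF xK[of 1]] diam[OF xX[of 1] \<open>v 1 \<in> X\<close>] order_trans[OF norm_ge_zero G[OF xK[of 1]]]
        by (intro mult_mono) auto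
      finally have "fw_gap f X (x 1) \<le> G * D" .
      moreover have "G * D * real T \<le> G * D * (2 * real t0)"
        using False \<open>D \<ge> 0\<close> order_trans[OF norm_ge_zero G[OF \<open>x0 \<in> K\<close>]] by (intro mult_left_mono) auto
      then have "G * D * real T \<le> C" by (simp add: C_def)
      then have "G * D \<le> C / real T" using \<open>T \<ge> 1\<close> by (simp add: field_simps)
      ultimately show ?thesis using \<open>T \<ge> 1\<close> by (intro bexI[of _ 1]) auto
    qed
    then show ?thesis by (subst Min_le_iff) auto
  qed
  then show ?thesis by blast
qed

end
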